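(* Given $n \geq 1$, let $N = \binom{n}{\lfloor n/2 \rfloor}$ and list all ballot sets $B_1, \ldots, B_N \subseteq [n] = \{1,\ldots,n\}$ in increasing order of size, with ties broken arbitrarily. Let $S_i = [n] \setminus B_i$ for all $1 \leq i \leq N$. For $0 \leq k \leq n$, consider the $\binom{n}{k} \times \binom{n}{k}$ matrix $A_{n,k}$ with rows indexed by $I \in \{S_i : 1 \leq i \leq \binom{n}{k}\}$ and columns indexed by the $k$-element subsets $J$ of $[n]$, where $A_{n,k}(I,J) = 1$ if $I \supseteq J$ and $A_{n,k}(I,J) = 0$ otherwise. Then $\det A_{n,k} \in \{\pm 1\}$ for every $0 \leq k \leq n$.
   Context: A set $B = \{x_1, \ldots, x_k\} \subseteq [n]$ with $x_1 < \cdots < x_k$ is a ballot set if $x_i \geq 2i$ for all $1 \leq i \leq k$; by convention the empty set is ballot. The total number of ballot subsets of $[n]$ is $\binom{n}{\lfloor n/2 \rfloor}$. The determinant is an integer determinant, taken with respect to any orderings of the row and column index sets (a change of ordering affects only its sign). *)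

theory Defs
  imports "Jordan_Normal_Form.Determinant"
begin

(* For a finite set B, sorted_list_of_set B ! (i - 1) is its i-th smallest element x_i. *)
definition ballot_set :: "nat \<Rightarrow> nat set \<Rightarrow> bool" where
  "ballot_set n B \<longleftrightarrow> B \<subseteq> {1..n} \<and>
     (\<forall>i\<in>{1..card B}. sorted_list_of_set B ! (i - 1) \<ge> 2 * i)"

definition ballot_listing :: "nat \<Rightarrow> (nat \<Rightarrow> nat set) \<Rightarrow> bool" where
  "ballot_listing n B \<longleftrightarrow>
     bij_betw B {1..n choose (n div 2)} {X. ballot_set n X} \<and>
     mono_on {1..n choose (n div 2)} (\<lambda>i. card (B i))"

definition k_subsets :: "nat \<Rightarrow> nat \<Rightarrow> nat set set" where
  "k_subsets n k = {J. J \<subseteq> {1..n} \<and> card J = k}"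

definition row_sets :: "nat \<Rightarrow> (nat \<Rightarrow> nat set) \<Rightarrow> nat \<Rightarrow> nat set set" where
  "row_sets n B k = (\<lambda>i. {1..n} - B i) ` {1..n choose k}"

(* Matrices are indexed from 0; r and c are the chosen orderings of the row and column index sets. *)
definition inclusion_mat :: "nat \<Rightarrow> (nat \<Rightarrow> 'a set) \<Rightarrow> (nat \<Rightarrow> 'a set) \<Rightarrow> int mat" where
  "inclusion_mat m r c = mat m m (\<lambda>(i, j). if r i \<supseteq> c j then 1 else 0)"

end

theory Submission
  imports Defs
begin

text \<open>
  Put \<open>m = min k (n - k)\<close>. The ballot sets of size at most \<open>m\<close> number \<open>n choose k\<close>, so, the listing
  being by size, the rows of the matrix are exactly the complements of these \<^emph>\<open>low\<close> ballot sets, and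
  the entry of row \<open>[n] - X\<close> and column \<open>J\<close> says whether \<open>X \<inter> J = {}\<close>. The determinant is a unit of
  the integers as soon as the matrix has an integer left inverse, that is, as soon as every
  integer-valued function of the \<open>k\<close>-subsets \<open>J\<close> is an integer combination of the functions
  \<open>[X \<inter> J = {}]\<close> with \<open>X\<close> low. Speaking of spans rather than of determinants makes the orderings of
  rows and columns irrelevant.

  Two ideas prove this spanning property (\<open>low_ballot_sets_span\<close>). First, low ballot sets are closed
  under subsets, so Moebius inversion on subsets turns the functions \<open>[X \<inter> J = {}]\<close> into the functions
  \<open>[X \<subseteq> J]\<close> and back by integer combinations: either kind spans if the other does
  (\<open>spans_subset_iff_disjoint\<close>). Secondly, one inducts on \<open>n\<close>, splitting both low sets and
  \<open>k\<close>-subsets by whether they contain the last point \<open>x\<close>. A set \<open>X\<close> containing \<open>x\<close> is never included in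
  a \<open>J\<close> avoiding \<open>x\<close>, and never disjoint from a \<open>J\<close> containing \<open>x\<close>; so with either kind of function the
  system is block triangular. The low sets split as those for \<open>k\<close> and those for \<open>k - 1\<close> on the
  smaller ground set, but which of the two parts is the one whose members contain \<open>x\<close> depends on
  whether \<open>2 k \<le> n\<close> (\<open>low_ballot_sets_Suc\<close>). Inclusion gives square diagonal blocks in the one case,
  disjointness in the other. The same splitting counts the low ballot sets by Pascal's rule.
\<close>

section \<open>Ballot sets as a recursive family\<close>

lemma card_le_nth_sorted_list_of_set:
  fixes B :: "'a::linorder set"
  assumes "finite B" and "i < card B"
  shows "card {y \<in> B. y \<le> sorted_list_of_set B ! i} = Suc i"
proof -
  define xs where "xs = sorted_list_of_set B"
  have len: "length xs = card B" and set: "set xs = B" and dist: "distinct xs" and "sorted xs"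
    using assms(1) by (simp_all add: xs_def)
  have mono: "xs ! j \<le> xs ! i \<longleftrightarrow> j \<le> i" if "j < card B" for j
    using \<open>sorted xs\<close> dist assms(2) that len
    by (metis linorder_le_cases nth_eq_iff_index_eq order_antisym sorted_nth_mono)
  have "{y \<in> B. y \<le> xs ! i} = (!) xs ` {..i}"
  proof (intro equalityI subsetI)
    fix y assume "y \<in> {y \<in> B. y \<le> xs ! i}"
    then show "y \<in> (!) xs ` {..i}"
      using set len mono by (auto simp: in_set_conv_nth)
  next
    fix y assume "y \<in> (!) xs ` {..i}"
    then show "y \<in> {y \<in> B. y \<le> xs ! i}"
      using set len mono assms(2) by auto
  qed
  moreover have "inj_on ((!) xs) {..i}"
    using dist len assms(2) by (auto simp: inj_on_def nth_eq_iff_index_eq)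
  ultimately show ?thesis
    by (simp add: card_image xs_def)
qed

text \<open>An element \<open>x\<close> of \<open>B\<close> sits at position \<open>card {y \<in> B. y \<le> x}\<close>, so the ballot condition can be
  read without sorting: no prefix of \<open>[n]\<close> that ends in an element of \<open>B\<close> is more than half full.
  In this form closure under subsets is monotonicity of cardinality.\<close>

lemma ballot_set_iff_prefix:
  "ballot_set n B \<longleftrightarrow> B \<subseteq> {1..n} \<and> (\<forall>x\<in>B. 2 * card {y \<in> B. y \<le> x} \<le> x)"
proof (cases "B \<subseteq> {1..n}")
  case True
  then have fin: "finite B"
    using finite_subset by blast
  have "(\<forall>i\<in>{1..card B}. sorted_list_of_set B ! (i - 1) \<ge> 2 * i)
      \<longleftrightarrow> (\<forall>i<card B. sorted_list_of_set B ! i \<ge> 2 * Suc i)"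
    by (metis atLeastAtMost_iff diff_Suc_1 le_add1 less_eq_Suc_le
        ordered_cancel_comm_monoid_diff_class.add_diff_inverse plus_1_eq_Suc)
  also have "\<dots> \<longleftrightarrow> (\<forall>i<card B. 2 * card {y \<in> B. y \<le> sorted_list_of_set B ! i}
                                \<le> sorted_list_of_set B ! i)"
    using card_le_nth_sorted_list_of_set[OF fin] by auto
  also have "\<dots> \<longleftrightarrow> (\<forall>x\<in>set (sorted_list_of_set B). 2 * card {y \<in> B. y \<le> x} \<le> x)"
    by (simp only: all_set_conv_all_nth sorted_list_of_set.length_sorted_key_list_of_set)
  finally show ?thesis
    using True fin by (simp add: ballot_set_def)
qed (simp add: ballot_set_def)

lemma ballot_set_finite: "ballot_set n B \<Longrightarrow> finite B"
  by (auto simp: ballot_set_def intro: finite_subset)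

lemma finite_ballot_sets: "finite {X. ballot_set n X}"
  by (rule finite_subset[of _ "Pow {1..n}"]) (auto simp: ballot_set_def)

lemma ballot_set_subset:
  assumes "ballot_set n B" and "C \<subseteq> B"
  shows "ballot_set n C"
proof -
  have "card {y \<in> C. y \<le> x} \<le> card {y \<in> B. y \<le> x}" for x
    using assms ballot_set_finite by (intro card_mono) auto
  then show ?thesis
    using assms unfolding ballot_set_iff_prefix
    by (meson mult_le_mono2 order_trans subsetD)
qed

lemma ballot_set_card_le:
  assumes "ballot_set n B"
  shows "2 * card B \<le> n"
proof (cases "B = {}")
  case False
  have fin: "finite B"
    using assms by (rule ballot_set_finite)
  have "{y \<in> B. y \<le> Max B} = B"
    using fin by auto
  then have "2 * card B \<le> Max B"
    using assms Max_in[OF fin False] by (metis ballot_set_iff_prefix)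
  also have "\<dots> \<le> n"
    using assms Max_in[OF fin False] by (auto simp: ballot_set_def)
  finally show ?thesis .
qed simp

lemma ballot_set_Suc_notin:
  assumes "Suc n \<notin> X"
  shows "ballot_set (Suc n) X \<longleftrightarrow> ballot_set n X"
  using assms by (simp add: ballot_set_iff_prefix atLeastAtMostSuc_conv subset_insert)

lemma ballot_set_Suc_insert:
  assumes "Suc n \<notin> X"
  shows "ballot_set (Suc n) (insert (Suc n) X) \<longleftrightarrow> ballot_set n X \<and> 2 * Suc (card X) \<le> Suc n"
proof
  assume *: "ballot_set (Suc n) (insert (Suc n) X)"
  then have "ballot_set n X"
    using ballot_set_subset ballot_set_Suc_notin[OF assms] by blast
  then show "ballot_set n X \<and> 2 * Suc (card X) \<le> Suc n"
    using ballot_set_card_le[OF *] assms ballot_set_finite by auto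
next
  assume *: "ballot_set n X \<and> 2 * Suc (card X) \<le> Suc n"
  then have fin: "finite X" and sub: "X \<subseteq> {1..n}"
    using ballot_set_finite[of n X] unfolding ballot_set_def by blast+
  have "{y \<in> insert (Suc n) X. y \<le> x} = {y \<in> X. y \<le> x}" if "x \<in> X" for x
    using that sub by auto
  moreover have "{y \<in> insert (Suc n) X. y \<le> Suc n} = insert (Suc n) X"
    using sub by auto
  ultimately show "ballot_set (Suc n) (insert (Suc n) X)"
    using * sub fin assms by (auto simp: ballot_set_iff_prefix)
qed

text \<open>The bound \<open>min k (n - k)\<close> is the one that makes the number of these sets \<open>n choose k\<close>: the
  ballot sets of size \<open>j \<le> n div 2\<close> number \<open>(n choose j) - (n choose (j - 1))\<close>, and this telescopes.\<close>

definition low_ballot_sets :: "nat \<Rightarrow> nat \<Rightarrow> nat set set" where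
  "low_ballot_sets n k = {X. ballot_set n X \<and> card X \<le> min k (n - k)}"

lemma finite_low_ballot_sets: "finite (low_ballot_sets n k)"
  using finite_ballot_sets by (rule rev_finite_subset) (auto simp: low_ballot_sets_def)

lemma low_ballot_sets_fin: "X \<in> low_ballot_sets n k \<Longrightarrow> finite X"
  using ballot_set_finite by (auto simp: low_ballot_sets_def)

lemma low_ballot_sets_subset:
  assumes "X \<in> low_ballot_sets n k" and "C \<subseteq> X"
  shows "C \<in> low_ballot_sets n k"
  using assms ballot_set_subset[of n X C] card_mono[OF low_ballot_sets_fin[OF assms(1)] assms(2)]
  by (simp add: low_ballot_sets_def)

lemma low_ballot_sets_bounded: "X \<in> low_ballot_sets n k \<Longrightarrow> Suc n \<notin> X"
  by (auto simp: low_ballot_sets_def ballot_set_def)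

lemma ballot_set_empty: "ballot_set n {}"
  by (simp add: ballot_set_def)

lemma low_ballot_sets_trivial:
  assumes "k = 0 \<or> k = n"
  shows "low_ballot_sets n k = {{}}"
  using assms ballot_set_empty ballot_set_finite by (auto simp: low_ballot_sets_def)

text \<open>Deleting the last point from a low set lowers both its size and the size of the ground set.
  If \<open>k\<close> is in the lower half, the bound in force is \<open>k\<close>, which stays for the sets that avoid the
  point and drops by one for the others: these are the low sets for \<open>k\<close> and \<open>k - 1\<close>. In the upper
  half the bound is \<open>n - k\<close> and the two roles are exchanged. At the boundary, where the bound for the
  smaller ground set is one less than the one inherited, \<open>ballot_set_card_le\<close> closes the gap.\<close>

lemma low_ballot_sets_Suc:
  assumes "k < n"
    and pq: "if 2 * Suc k \<le> Suc n then p = Suc k \<and> q = k else p = k \<and> q = Suc k"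
  shows "low_ballot_sets (Suc n) (Suc k)
       = low_ballot_sets n p \<union> insert (Suc n) ` low_ballot_sets n q"
proof (rule Set.set_eqI)
  fix X
  show "X \<in> low_ballot_sets (Suc n) (Suc k)
    \<longleftrightarrow> X \<in> low_ballot_sets n p \<union> insert (Suc n) ` low_ballot_sets n q"
  proof (cases "Suc n \<in> X")
    case False
    have "ballot_set n X \<Longrightarrow> 2 * card X \<le> n"
      by (rule ballot_set_card_le)
    then have "X \<in> low_ballot_sets (Suc n) (Suc k) \<longleftrightarrow> X \<in> low_ballot_sets n p"
      using pq assms(1) unfolding low_ballot_sets_def mem_Collect_eq ballot_set_Suc_notin[OF False]
      by (auto split: if_splits)
    then show ?thesis
      using False by auto
  next
    case True
    define Y where "Y = X - {Suc n}"
    have X: "X = insert (Suc n) Y" and Y: "Suc n \<notin> Y"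
      using True by (auto simp: Y_def)
    have "ballot_set n Y \<Longrightarrow> card X = Suc (card Y)"
      using X Y ballot_set_finite by simp
    then have "X \<in> low_ballot_sets (Suc n) (Suc k) \<longleftrightarrow> Y \<in> low_ballot_sets n q"
      using pq assms(1) ballot_set_Suc_insert[OF Y] X
      unfolding low_ballot_sets_def mem_Collect_eq
      by (auto split: if_splits)
    moreover have "Y \<in> low_ballot_sets n q \<longleftrightarrow> X \<in> insert (Suc n) ` low_ballot_sets n q"
      using X Y low_ballot_sets_bounded by (auto simp: image_iff insert_ident)
    moreover have "X \<notin> low_ballot_sets n p"
      using True low_ballot_sets_bounded by blast
    ultimately show ?thesis
      by simp
  qed
qed

lemma card_low_ballot_sets: "k \<le> n \<Longrightarrow> card (low_ballot_sets n k) = n choose k"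
proof (induction n arbitrary: k)
  case 0
  then show ?case by (simp add: low_ballot_sets_trivial)
next
  case (Suc n)
  show ?case
  proof (cases "k = 0 \<or> k = Suc n")
    case True
    then show ?thesis by (auto simp: low_ballot_sets_trivial)
  next
    case False
    then obtain l where k: "k = Suc l" and l: "l < n"
      using Suc.prems by (cases k) auto
    obtain p q where pq: "if 2 * Suc l \<le> Suc n then p = Suc l \<and> q = l else p = l \<and> q = Suc l"
      by (metis (full_types))
    have "inj_on (insert (Suc n)) (low_ballot_sets n q)"
      using low_ballot_sets_bounded by (auto simp: inj_on_def insert_ident)
    moreover have "low_ballot_sets n p \<inter> insert (Suc n) ` low_ballot_sets n q = {}"
      using low_ballot_sets_bounded by auto
    ultimately have "card (low_ballot_sets (Suc n) k)
        = card (low_ballot_sets n p) + card (low_ballot_sets n q)"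
      unfolding k low_ballot_sets_Suc[OF l pq]
      by (simp add: card_Un_disjoint finite_low_ballot_sets card_image)
    also have "\<dots> = (n choose Suc l) + (n choose l)"
      using pq l Suc.IH by (auto split: if_splits)
    finally show ?thesis
      by (simp add: k)
  qed
qed

section \<open>Integer spans of incidence functions\<close>

text \<open>The functions \<open>[R X -]\<close>, for \<open>X\<close> in \<open>F\<close>, generate the group of all integer-valued functions
  on \<open>K\<close>. When \<open>F\<close> and \<open>K\<close> have the same finite size, this says that the incidence matrix of \<open>R\<close> is
  unimodular.\<close>

definition spans :: "'a set \<Rightarrow> ('a \<Rightarrow> 'b \<Rightarrow> bool) \<Rightarrow> 'b set \<Rightarrow> bool" where
  "spans F R K \<longleftrightarrow>
     (\<forall>f :: 'b \<Rightarrow> int. \<exists>a. \<forall>J\<in>K. f J = (\<Sum>X\<in>F. a X * of_bool (R X J)))"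

lemma spans_singleton:
  assumes "R X J"
  shows "spans {X} R {J}"
  unfolding spans_def
proof
  fix f :: "_ \<Rightarrow> int"
  show "\<exists>a. \<forall>J\<in>{J}. f J = (\<Sum>X\<in>{X}. a X * of_bool (R X J))"
    using assms by (intro exI[of _ "\<lambda>_. f J"]) simp
qed

lemma spans_image:
  assumes "spans F R K" and h: "inj_on h F" and g: "inj_on g K"
    and R: "\<And>X J. X \<in> F \<Longrightarrow> J \<in> K \<Longrightarrow> R' (h X) (g J) \<longleftrightarrow> R X J"
  shows "spans (h ` F) R' (g ` K)"
  unfolding spans_def
proof
  fix f :: "_ \<Rightarrow> int"
  obtain a where a: "\<And>J. J \<in> K \<Longrightarrow> f (g J) = (\<Sum>X\<in>F. a X * of_bool (R X J))"
    using assms(1)[unfolded spans_def, rule_format, of "f \<circ> g"] by auto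
  have "f (g J) = (\<Sum>X\<in>h ` F. a (inv_into F h X) * of_bool (R' X (g J)))" if "J \<in> K" for J
    unfolding a[OF that] sum.reindex[OF h] using h R that by (intro sum.cong) auto
  then show "\<exists>a. \<forall>J\<in>g ` K. f J = (\<Sum>X\<in>h ` F. a X * of_bool (R' X J))"
    by (intro exI[of _ "a \<circ> inv_into F h"]) auto
qed

text \<open>Solving a block triangular system: \<open>F1\<close> is used to match the function on \<open>K1\<close>, and \<open>F2\<close> then
  corrects the remainder on \<open>K2\<close> without disturbing \<open>K1\<close>.\<close>

lemma spans_Un:
  assumes "finite F1" "finite F2" "F1 \<inter> F2 = {}"
    and "spans F1 R K1" "spans F2 R K2"
    and zero: "\<And>X J. X \<in> F2 \<Longrightarrow> J \<in> K1 \<Longrightarrow> \<not> R X J"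
  shows "spans (F1 \<union> F2) R (K1 \<union> K2)"
  unfolding spans_def
proof
  fix f :: "_ \<Rightarrow> int"
  obtain a where a: "\<And>J. J \<in> K1 \<Longrightarrow> f J = (\<Sum>X\<in>F1. a X * of_bool (R X J))"
    using assms(4)[unfolded spans_def, rule_format, of f] by auto
  define g where "g J = f J - (\<Sum>X\<in>F1. a X * of_bool (R X J))" for J
  obtain b where b: "\<And>J. J \<in> K2 \<Longrightarrow> g J = (\<Sum>X\<in>F2. b X * of_bool (R X J))"
    using assms(5)[unfolded spans_def, rule_format, of g] by auto
  define c where "c X = (if X \<in> F1 then a X else b X)" for X
  have "(\<Sum>X\<in>F1 \<union> F2. c X * of_bool (R X J))
      = (\<Sum>X\<in>F1. a X * of_bool (R X J)) + (\<Sum>X\<in>F2. b X * of_bool (R X J))" for J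
    unfolding sum.union_disjoint[OF assms(1-3)]
    using assms(3) by (intro arg_cong2[of _ _ _ _ "(+)"] sum.cong) (auto simp: c_def)
  moreover have "(\<Sum>X\<in>F2. b X * of_bool (R X J)) = 0" if "J \<in> K1" for J
    using zero that by (intro sum.neutral) auto
  ultimately have "f J = (\<Sum>X\<in>F1 \<union> F2. c X * of_bool (R X J))" if "J \<in> K1 \<union> K2" for J
    using that a b[unfolded g_def] by (auto simp: diff_eq_eq add.commute)
  then show "\<exists>a. \<forall>J\<in>K1 \<union> K2. f J = (\<Sum>X\<in>F1 \<union> F2. a X * of_bool (R X J))"
    by blast
qed

lemma spans_change_of_basis:
  assumes "finite F" and span: "spans F R K"
    and R: "\<And>X J. X \<in> F \<Longrightarrow> J \<in> K \<Longrightarrow>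
      (of_bool (R X J) :: int) = (\<Sum>C\<in>F. m X C * of_bool (S C J))"
  shows "spans F S K"
  unfolding spans_def
proof
  fix f :: "_ \<Rightarrow> int"
  obtain a where a: "\<And>J. J \<in> K \<Longrightarrow> f J = (\<Sum>X\<in>F. a X * of_bool (R X J))"
    using span[unfolded spans_def, rule_format, of f] by auto
  have "f J = (\<Sum>C\<in>F. (\<Sum>X\<in>F. a X * m X C) * of_bool (S C J))" if "J \<in> K" for J
  proof -
    have "f J = (\<Sum>X\<in>F. \<Sum>C\<in>F. a X * m X C * of_bool (S C J))"
      using that by (simp add: a R sum_distrib_left mult.assoc)
    also have "\<dots> = (\<Sum>C\<in>F. (\<Sum>X\<in>F. a X * m X C) * of_bool (S C J))"
      by (subst sum.swap) (simp add: sum_distrib_right)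
    finally show ?thesis .
  qed
  then show "\<exists>b. \<forall>J\<in>K. f J = (\<Sum>C\<in>F. b C * of_bool (S C J))"
    by (intro exI[of _ "\<lambda>C. \<Sum>X\<in>F. a X * m X C"] ballI)
qed

text \<open>This is the binomial expansion of \<open>(1 - 1) ^ card X\<close>.\<close>

lemma sum_Pow_minus_one:
  assumes "finite X"
  shows "(\<Sum>C\<in>Pow X. (- 1) ^ card C) = (of_bool (X = {}) :: int)"
  using assms
proof (induction X rule: finite_induct)
  case (insert x X)
  have "inj_on (insert x) (Pow X)"
    using insert.hyps by (auto simp: inj_on_def insert_ident Pow_def)
  moreover have "card (insert x C) = Suc (card C)" if "C \<in> Pow X" for C
    using that insert.hyps finite_subset by (subst card_insert_disjoint) auto
  ultimately have "(\<Sum>C\<in>insert x ` Pow X. (- 1) ^ card C) = - (\<Sum>C\<in>Pow X. (- 1) ^ card C :: int)"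
    by (simp add: sum.reindex sum_negf)
  moreover have "Pow X \<inter> insert x ` Pow X = {}"
    using insert.hyps by auto
  ultimately show ?case
    using insert.hyps by (simp add: Pow_insert sum.union_disjoint)
qed simp

text \<open>Only the subsets of \<open>X \<inter> Y\<close> contribute to the right-hand side, so it is the alternating sum
  over \<open>Pow (X \<inter> Y)\<close>.\<close>

lemma moebius_subset:
  assumes "finite X"
  shows "(of_bool (X \<inter> Y = {}) :: int) = (\<Sum>C\<in>Pow X. (- 1) ^ card C * of_bool (C \<subseteq> Y))"
proof -
  have "(\<Sum>C\<in>Pow X. (- 1) ^ card C * of_bool (C \<subseteq> Y)) = (\<Sum>C\<in>Pow (X \<inter> Y). (- 1) ^ card C :: int)"
    using assms by (intro sum.mono_neutral_cong_right) auto
  then show ?thesis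
    using sum_Pow_minus_one[of "X \<inter> Y"] assms by simp
qed

text \<open>Moebius inversion writes \<open>[X \<inter> J = {}]\<close> in terms of the \<open>[C \<subseteq> J]\<close> with \<open>C \<subseteq> X\<close>, all of which lie
  in the down-closed family \<open>F\<close>. Replacing \<open>J\<close> by its complement exchanges the two kinds of
  function, so the same coefficients serve for the way back.\<close>

lemma spans_subset_iff_disjoint:
  assumes "finite F" and fin: "\<And>X. X \<in> F \<Longrightarrow> finite X"
    and down: "\<And>X C. X \<in> F \<Longrightarrow> C \<subseteq> X \<Longrightarrow> C \<in> F"
  shows "spans F (\<subseteq>) K \<longleftrightarrow> spans F (\<lambda>X J. X \<inter> J = {}) K"
proof -
  define m :: "'a set \<Rightarrow> 'a set \<Rightarrow> int" where "m X C = (if C \<subseteq> X then (- 1) ^ card C else 0)" for X C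
  have m: "(of_bool (X \<inter> Y = {}) :: int) = (\<Sum>C\<in>F. m X C * of_bool (C \<subseteq> Y))" if "X \<in> F" for X Y
    unfolding moebius_subset[OF fin[OF that]] m_def
    using assms(1) down that by (intro sum.mono_neutral_cong_left) auto
  have "(of_bool (X \<subseteq> J) :: int) = (\<Sum>C\<in>F. m X C * of_bool (C \<inter> J = {}))" if "X \<in> F" for X J
    using m[OF that, of "- J"] by (simp add: disjoint_eq_subset_Compl)
  then show ?thesis
    using spans_change_of_basis[OF assms(1), of "(\<subseteq>)" K m "\<lambda>X J. X \<inter> J = {}"]
      spans_change_of_basis[OF assms(1), of "\<lambda>X J. X \<inter> J = {}" K m "(\<subseteq>)"] m
    by blast
qed

section \<open>Spanning the functions on the k-subsets\<close>

lemma k_subsets_bounded: "J \<in> k_subsets n k \<Longrightarrow> Suc n \<notin> J"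
  by (auto simp: k_subsets_def)

lemma k_subsets_Suc:
  "k_subsets (Suc n) (Suc k) = k_subsets n (Suc k) \<union> insert (Suc n) ` k_subsets n k"
proof (rule Set.set_eqI)
  fix J
  show "J \<in> k_subsets (Suc n) (Suc k) \<longleftrightarrow> J \<in> k_subsets n (Suc k) \<union> insert (Suc n) ` k_subsets n k"
  proof (cases "Suc n \<in> J")
    case False
    then show ?thesis by (auto simp: k_subsets_def subset_iff le_Suc_eq)
  next
    case True
    define L where "L = J - {Suc n}"
    have J: "J = insert (Suc n) L" and L: "Suc n \<notin> L"
      using True by (auto simp: L_def)
    have "J \<in> k_subsets (Suc n) (Suc k) \<longleftrightarrow> L \<in> k_subsets n k"
    proof (cases "finite L")
      case True
      then show ?thesis using J L by (auto simp: k_subsets_def subset_iff le_Suc_eq)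
    next
      case False
      then show ?thesis using J by (auto simp: k_subsets_def dest: finite_subset)
    qed
    moreover have "L \<in> k_subsets n k \<longleftrightarrow> J \<in> insert (Suc n) ` k_subsets n k"
      using J L k_subsets_bounded by (auto simp: image_iff insert_ident)
    moreover have "J \<notin> k_subsets n (Suc k)"
      using True by (auto simp: k_subsets_def)
    ultimately show ?thesis by simp
  qed
qed

lemma k_subsets_trivial:
  assumes "k = 0 \<or> k = n"
  shows "k_subsets n k = {{1..k}}"
proof -
  have "J \<in> k_subsets n k \<longleftrightarrow> J = {1..k}" for J
    using assms finite_subset[of J "{1..n}"] card_subset_eq[of "{1..n}" J]
    by (auto simp: k_subsets_def)
  then show ?thesis by blast
qed

text \<open>The induction step is a block triangular system in the last point \<open>x\<close>. In the lower half it is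
  solved for the functions \<open>[X \<subseteq> J]\<close>, first on the \<open>J\<close> that avoid \<open>x\<close>; in the upper half for the
  functions \<open>[X \<inter> J = {}]\<close>, first on the \<open>J\<close> that contain \<open>x\<close>. The other two combinations would in general pair
  blocks of different sizes.\<close>

lemma low_ballot_sets_span: "k \<le> n \<Longrightarrow> spans (low_ballot_sets n k) (\<subseteq>) (k_subsets n k)"
proof (induction n arbitrary: k)
  case 0
  then show ?case
    by (simp add: low_ballot_sets_trivial k_subsets_trivial spans_singleton)
next
  case (Suc n)
  show ?case
  proof (cases "k = 0 \<or> k = Suc n")
    case True
    then show ?thesis
      by (simp add: low_ballot_sets_trivial k_subsets_trivial spans_singleton)
  next
    case False
    then obtain l where k: "k = Suc l" and l: "l < n"
      using Suc.prems by (cases k) auto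
    let ?x = "Suc n"
    have disj: "low_ballot_sets n p \<inter> insert ?x ` low_ballot_sets n q = {}" for p q
      using low_ballot_sets_bounded by auto
    have inj_low: "inj_on (insert ?x) (low_ballot_sets n q)" for q
      using low_ballot_sets_bounded by (auto simp: inj_on_def insert_ident)
    have inj_k: "inj_on (insert ?x) (k_subsets n q)" for q
      using k_subsets_bounded by (auto simp: inj_on_def insert_ident)
    note glue = spans_Un[OF finite_low_ballot_sets finite_imageI[OF finite_low_ballot_sets] disj]
    note convert = spans_subset_iff_disjoint[OF finite_low_ballot_sets
        low_ballot_sets_fin low_ballot_sets_subset]
    show ?thesis
    proof (cases "2 * Suc l \<le> Suc n")
      case True
      have "spans (insert ?x ` low_ballot_sets n l) (\<subseteq>) (insert ?x ` k_subsets n l)"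
      proof (intro spans_image[where R = "(\<subseteq>)"] inj_low inj_k)
        show "spans (low_ballot_sets n l) (\<subseteq>) (k_subsets n l)"
          using Suc.IH l by simp
        fix X J assume "X \<in> low_ballot_sets n l"
        then show "insert ?x X \<subseteq> insert ?x J \<longleftrightarrow> X \<subseteq> J"
          using low_ballot_sets_bounded by blast
      qed
      then have "spans (low_ballot_sets n (Suc l) \<union> insert ?x ` low_ballot_sets n l) (\<subseteq>)
          (k_subsets n (Suc l) \<union> insert ?x ` k_subsets n l)"
        using Suc.IH[of "Suc l"] l k_subsets_bounded by (intro glue) auto
      then show ?thesis
        using low_ballot_sets_Suc[OF l, of "Suc l" l] True by (simp add: k k_subsets_Suc)
    next
      case False
      \<comment> \<open>Membership of \<open>x\<close> in \<open>J\<close> does not affect disjointness from sets avoiding \<open>x\<close>, and membership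
         of \<open>x\<close> in \<open>X\<close> does not affect it for \<open>J\<close> avoiding \<open>x\<close>. The \<open>id\<close> brings these one-sided changes
         into the form of \<open>spans_image\<close>.\<close>
      let ?D = "\<lambda>X J :: nat set. X \<inter> J = {}"
      have IH: "spans (low_ballot_sets n q) ?D (k_subsets n q)" if "q \<le> n" for q
        using Suc.IH[OF that] by (simp add: convert)
      have "spans (id ` low_ballot_sets n l) ?D (insert ?x ` k_subsets n l)"
        using IH[of l] l low_ballot_sets_bounded
        by (intro spans_image[where R = ?D] inj_k) auto
      moreover have "spans (insert ?x ` low_ballot_sets n (Suc l)) ?D (id ` k_subsets n (Suc l))"
        using IH[of "Suc l"] l k_subsets_bounded
        by (intro spans_image[where R = ?D] inj_low) auto
      ultimately have "spans (low_ballot_sets n l \<union> insert ?x ` low_ballot_sets n (Suc l)) ?D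
          (insert ?x ` k_subsets n l \<union> k_subsets n (Suc l))"
        by (intro glue) auto
      then have "spans (low_ballot_sets (Suc n) k) ?D (k_subsets (Suc n) k)"
        using low_ballot_sets_Suc[OF l, of l "Suc l"] False
        by (simp add: k k_subsets_Suc Un_commute)
      then show ?thesis
        by (simp add: convert)
    qed
  qed
qed

section \<open>From the listing to the determinant\<close>

lemma down_closed_eq_atLeastAtMost:
  assumes "D \<subseteq> {1..N}" and "\<And>i j. j \<in> D \<Longrightarrow> 1 \<le> i \<Longrightarrow> i \<le> j \<Longrightarrow> i \<in> D"
  shows "D = {1..card D}"
proof (cases "D = {}")
  case False
  have "finite D"
    using assms(1) finite_subset by blast
  then have "D = {1..Max D}"
    using assms Max_in[OF _ False] by (auto intro: Max_ge)
  then show ?thesis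
    by (metis card_atLeastAtMost diff_Suc_1)
qed simp

text \<open>Since the listing is by size, the indices of the low ballot sets form an initial segment, whose
  length is the number of low ballot sets. Ties in size cannot matter, as the low sets comprise
  whole size classes.\<close>

lemma ballot_listing_initial_segment:
  assumes "ballot_listing n B" and "k \<le> n"
  shows "B ` {1..n choose k} = low_ballot_sets n k"
proof -
  let ?N = "n choose (n div 2)" and ?m = "min k (n - k)"
  have bij: "bij_betw B {1..?N} {X. ballot_set n X}"
    and mono: "mono_on {1..?N} (\<lambda>i. card (B i))"
    using assms(1) by (auto simp: ballot_listing_def)
  define D where "D = {i \<in> {1..?N}. card (B i) \<le> ?m}"
  have "B ` D = {X \<in> B ` {1..?N}. card X \<le> ?m}"
    unfolding D_def by blast
  then have BD: "B ` D = low_ballot_sets n k"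
    unfolding bij_betw_imp_surj_on[OF bij] low_ballot_sets_def by simp
  have "inj_on B D"
    using bij by (auto simp: D_def bij_betw_def inj_on_def)
  then have "card D = n choose k"
    using card_image[of B D] BD card_low_ballot_sets[OF assms(2)] by simp
  moreover have "D = {1..card D}"
  proof (rule down_closed_eq_atLeastAtMost)
    fix i j assume "j \<in> D" "1 \<le> i" "i \<le> j"
    moreover from this have "card (B i) \<le> card (B j)"
      by (intro mono_onD[OF mono]) (auto simp: D_def)
    ultimately show "i \<in> D"
      by (auto simp: D_def)
  qed (auto simp: D_def)
  ultimately show ?thesis
    using BD by simp
qed

theorem theorem3p3:
  fixes n k :: nat and B r c :: "nat \<Rightarrow> nat set"
  assumes "n \<ge> 1"
    and "ballot_listing n B"
    and "k \<le> n"
    and "bij_betw r {0..<n choose k} (row_sets n B k)"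
    and "bij_betw c {0..<n choose k} (k_subsets n k)"
  shows "det (inclusion_mat (n choose k) r c) \<in> {1, -1}"
proof -
  let ?M = "n choose k" and ?L = "low_ballot_sets n k"
  let ?A = "inclusion_mat ?M r c"
  define s where "s i = {1..n} - r i" for i
  have rows: "row_sets n B k = (\<lambda>X. {1..n} - X) ` ?L"
    unfolding row_sets_def ballot_listing_initial_segment[OF assms(2,3), symmetric]
    by (simp add: image_image)
  have L_sub: "X \<subseteq> {1..n}" if "X \<in> ?L" for X
    using that by (auto simp: low_ballot_sets_def ballot_set_def)
  have "bij_betw (\<lambda>Y. {1..n} - Y) (row_sets n B k) ?L"
    unfolding rows by (rule bij_betw_byWitness[where f' = "\<lambda>X. {1..n} - X"])
      (use L_sub in \<open>auto simp: double_diff\<close>)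
  then have s: "bij_betw s {0..<?M} ?L"
    using bij_betw_trans[OF assms(4)] by (simp add: s_def[abs_def] comp_def)
  have entry: "?A $$ (i, j) = of_bool (s i \<inter> c j = {})" if "i < ?M" "j < ?M" for i j
  proof -
    have "c j \<subseteq> {1..n}"
      using assms(5) that(2) by (auto simp: bij_betw_def k_subsets_def)
    then have "c j \<subseteq> r i \<longleftrightarrow> s i \<inter> c j = {}"
      by (auto simp: s_def)
    then show ?thesis
      using that by (simp add: inclusion_mat_def)
  qed
  have "spans ?L (\<lambda>X J. X \<inter> J = {}) (k_subsets n k)"
    using low_ballot_sets_span[OF assms(3)]
    by (simp add: spans_subset_iff_disjoint[OF finite_low_ballot_sets
          low_ballot_sets_fin low_ballot_sets_subset])
  \<comment> \<open>Row \<open>l\<close> of the left inverse holds the coefficients of the indicator function of the column \<open>c l\<close>.\<close>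
  then have "\<forall>l. \<exists>a. \<forall>J\<in>k_subsets n k.
      of_bool (J = c l) = (\<Sum>X\<in>?L. a X * (of_bool (X \<inter> J = {}) :: int))"
    by (auto simp only: spans_def)
  then obtain a where a: "\<And>l J. J \<in> k_subsets n k \<Longrightarrow>
      of_bool (J = c l) = (\<Sum>X\<in>?L. a l X * (of_bool (X \<inter> J = {}) :: int))"
    by metis
  define P where "P = mat ?M ?M (\<lambda>(l, i). a l (s i))"
  have A: "?A \<in> carrier_mat ?M ?M" and P: "P \<in> carrier_mat ?M ?M"
    by (auto simp: inclusion_mat_def P_def)
  have "P * ?A = 1\<^sub>m ?M"
  proof (rule eq_matI)
    fix l j assume "l < dim_row (1\<^sub>m ?M :: int mat)" "j < dim_col (1\<^sub>m ?M :: int mat)"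
    then have lj: "l < ?M" "j < ?M" by auto
    have "(P * ?A) $$ (l, j) = (\<Sum>i\<in>{0..<?M}. P $$ (l, i) * ?A $$ (i, j))"
      using lj A P by (auto simp: scalar_prod_def intro!: sum.cong)
    also have "\<dots> = (\<Sum>i\<in>{0..<?M}. a l (s i) * of_bool (s i \<inter> c j = {}))"
      using lj by (intro sum.cong) (auto simp: entry P_def)
    also have "\<dots> = (\<Sum>X\<in>?L. a l X * of_bool (X \<inter> c j = {}))"
      by (rule sum.reindex_bij_betw[OF s])
    also have "\<dots> = of_bool (c j = c l)"
      using assms(5) lj by (intro a[symmetric]) (auto simp: bij_betw_def)
    also have "\<dots> = 1\<^sub>m ?M $$ (l, j)"
      using assms(5) lj by (auto simp: bij_betw_def inj_on_def)
    finally show "(P * ?A) $$ (l, j) = 1\<^sub>m ?M $$ (l, j)" .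
  qed (use A P in auto)
  then have "det P * det ?A = 1"
    using det_mult[OF P A] by simp
  then have "det ?A dvd 1"
    by (metis dvd_triv_right)
  then show ?thesis
    by (auto simp: zdvd1_eq)
qed

end
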